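(* Let $d\ge1$, let $\Omega\subset\mathbb{R}^d$ be a non-empty bounded open set and let $\theta\in\mathcal{S}$. Let $A$ be a non-empty element of $\mathcal{B}(\partial_\theta\Omega)$, the family of all Borel sets of $\partial_\theta\Omega\subset\partial\Omega$. Then $\mu_\theta(A)>0$ if and only if $\lambda^{d-1}(\mathcal{P}_\theta(A))>0$.
   Context: $\partial\Omega=\overline\Omega\setminus\Omega$, $\mathcal{S}=\{x\in\mathbb{R}^d:|x|=1\}$ (Euclidean norm). For $\theta\in\mathcal{S}$ and $x\in\Omega$, $\delta_\theta(x)=\sup\{s\in[0,+\infty):\ \forall t\in[0,s[,\ x+t\theta\in\Omega\}$ and $z_\theta(x)=x+\delta_\theta(x)\theta\in\partial\Omega$; $\partial_\theta\Omega=z_\theta(\Omega)\subset\partial\Omega$. The directional measure $\mu_\theta$ is the finite measure on the Borel sets of $\partial\Omega$ given by $\mu_\theta(A)=\int_\Omega\chi_A(z_\theta(x))\,\mathrm{d}x$, where $\chi_A$ is the characteristic function of $A$. $H_\theta$ is the hyperplane through $0$ orthogonal to $\theta$, $\mathcal{P}_\theta(x)=x-(x\cdot\theta)\theta$ is the orthogonal projection onto $H_\theta$, and $\lambda^{d-1}$ is the $(d-1)$-dimensional Lebesgue measure on $H_\theta$ (identified with $\mathbb{R}^{d-1}$ by a linear isometry). *)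

theory Defs
  imports "HOL-Analysis.Analysis"
begin

definition bdry :: "(real^'n) set \<Rightarrow> (real^'n) set" where
  "bdry \<Omega> = closure \<Omega> - \<Omega>"

(* For bounded \<Omega>, x in \<Omega> and a unit vector \<theta> the set below contains 0 and is bounded,
   so Sup is the genuine supremum. *)
definition dir_dist :: "(real^'n) set \<Rightarrow> real^'n \<Rightarrow> real^'n \<Rightarrow> real" where
  "dir_dist \<Omega> \<theta> x = Sup {s. 0 \<le> s \<and> (\<forall>t\<in>{0..<s}. x + t *\<^sub>R \<theta> \<in> \<Omega>)}"

definition dir_exit :: "(real^'n) set \<Rightarrow> real^'n \<Rightarrow> real^'n \<Rightarrow> real^'n" where
  "dir_exit \<Omega> \<theta> x = x + dir_dist \<Omega> \<theta> x *\<^sub>R \<theta>"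

definition dir_bdry :: "(real^'n) set \<Rightarrow> real^'n \<Rightarrow> (real^'n) set" where
  "dir_bdry \<Omega> \<theta> = dir_exit \<Omega> \<theta> ` \<Omega>"

(* measure_of yields the given set function only if that is countably additive;
   for bounded open \<Omega> this is emeasure_dir_measure below. *)
definition dir_measure :: "(real^'n) set \<Rightarrow> real^'n \<Rightarrow> (real^'n) measure" where
  "dir_measure \<Omega> \<theta> = measure_of (bdry \<Omega>) (sets (restrict_space borel (bdry \<Omega>)))
     (\<lambda>A. \<integral>\<^sup>+x\<in>\<Omega>. indicator A (dir_exit \<Omega> \<theta> x) \<partial>lborel)"

definition hyp :: "real^'n \<Rightarrow> (real^'n) set" where
  "hyp \<theta> = {x. x \<bullet> \<theta> = 0}"

definition hyp_proj :: "real^'n \<Rightarrow> real^'n \<Rightarrow> real^'n" where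
  "hyp_proj \<theta> x = x - (x \<bullet> \<theta>) *\<^sub>R \<theta>"

(* An orthonormal basis e 0, ..., e (d - 2) of the hyperplane orthogonal to \<theta>, where d = CARD('n).
   Such families are exactly the images of the standard basis under the linear isometries
   from R^(d-1) onto this hyperplane. *)
definition hyp_frame :: "real^'n \<Rightarrow> (nat \<Rightarrow> real^'n) \<Rightarrow> bool" where
  "hyp_frame \<theta> e \<longleftrightarrow>
     (\<forall>i<CARD('n) - 1. e i \<in> hyp \<theta>) \<and>
     (\<forall>i<CARD('n) - 1. \<forall>j<CARD('n) - 1. e i \<bullet> e j = (if i = j then 1 else 0))"

(* The linear isometry belonging to e; R^(d-1) is modelled as the space of
   functions on {..<d - 1}, a single point if d = 1. *)
definition hyp_isom :: "(nat \<Rightarrow> real^'n) \<Rightarrow> (nat \<Rightarrow> real) \<Rightarrow> real^'n" where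
  "hyp_isom e y = (\<Sum>i<CARD('n) - 1. y i *\<^sub>R e i)"

(* (d-1)-dimensional Lebesgue measure on the hyperplane orthogonal to \<theta>, transported along the
   isometry of a frame e. For d = 1 it is the unit point mass at 0. *)
definition hyp_lebesgue :: "real^'n \<Rightarrow> (nat \<Rightarrow> real^'n) \<Rightarrow> (real^'n) measure" where
  "hyp_lebesgue \<theta> e = completion
     (distr (\<Pi>\<^sub>M i\<in>{..<CARD('n) - 1}. lborel) (restrict_space borel (hyp \<theta>)) (hyp_isom e))"


lemma hyp_frame_exists:
  fixes \<theta> :: "real^'n"
  assumes "\<theta> \<in> sphere 0 1"
  shows "\<exists>e. hyp_frame \<theta> e"
proof -
  have "\<theta> \<noteq> 0" using assms by auto
  have hyp_eq: "hyp \<theta> = {x. \<theta> \<bullet> x = 0}"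
    by (simp add: hyp_def inner_commute)
  have sub: "subspace (hyp \<theta>)"
    unfolding hyp_eq by (rule subspace_hyperplane)
  have dim: "dim (hyp \<theta>) = CARD('n) - 1"
    unfolding hyp_eq using dim_hyperplane[OF \<open>\<theta> \<noteq> 0\<close>] by simp
  obtain B where B: "B \<subseteq> hyp \<theta>" "pairwise orthogonal B" "\<And>x. x \<in> B \<Longrightarrow> norm x = 1"
      "independent B" "card B = dim (hyp \<theta>)" "span B = hyp \<theta>"
    by (rule orthonormal_basis_subspace[OF sub]) blast
  have "finite B" using B(4) by (rule independent_imp_finite)
  then obtain e where e: "bij_betw e {..<CARD('n) - 1} B"
    using B(5) dim bij_betw_iff_card[of "{..<CARD('n) - 1}" B] by auto
  have mem: "e i \<in> B" if "i < CARD('n) - 1" for i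
    using e that by (auto simp: bij_betw_def)
  have "e i \<bullet> e j = (if i = j then 1 else 0)"
    if ij: "i < CARD('n) - 1" "j < CARD('n) - 1" for i j
  proof (cases "i = j")
    case True
    then show ?thesis using B(3)[OF mem[OF ij(1)]] by (simp add: norm_eq_1)
  next
    case False
    then have "e i \<noteq> e j" using e ij by (auto simp: bij_betw_def inj_on_def)
    then show ?thesis
      using B(2) mem[OF ij(1)] mem[OF ij(2)] False by (auto simp: pairwise_def orthogonal_def)
  qed
  then show ?thesis
    using mem B(1) unfolding hyp_frame_def by blast
qed

lemma inner_hyp_isom_frame:
  fixes \<theta> :: "real^'n"
  assumes "hyp_frame \<theta> e" and "j < CARD('n) - 1"
  shows "hyp_isom e x \<bullet> e j = x j"
proof -
  have "hyp_isom e x \<bullet> e j = (\<Sum>i\<in>{..<CARD('n) - 1}. if i = j then x i else 0)"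
    unfolding hyp_isom_def inner_sum_left using assms
    by (intro sum.cong refl) (auto simp: hyp_frame_def)
  then show ?thesis using assms(2) by simp
qed

lemma inner_hyp_isom:
  fixes \<theta> :: "real^'n"
  assumes "hyp_frame \<theta> e"
  shows "hyp_isom e x \<bullet> hyp_isom e y = (\<Sum>i<CARD('n) - 1. x i * y i)"
proof -
  have "hyp_isom e x \<bullet> hyp_isom e y = (\<Sum>i<CARD('n) - 1. y i * (hyp_isom e x \<bullet> e i))"
    unfolding hyp_isom_def[of e y] by (simp only: inner_sum_right inner_scaleR_right)
  also have "\<dots> = (\<Sum>i<CARD('n) - 1. x i * y i)"
    using inner_hyp_isom_frame[OF assms] by (intro sum.cong refl) simp
  finally show ?thesis .
qed

lemma hyp_isom_measurable:
  fixes \<theta> :: "real^'n"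
  assumes "hyp_frame \<theta> e"
  shows "hyp_isom e \<in> measurable (\<Pi>\<^sub>M i\<in>{..<CARD('n) - 1}. lborel) (restrict_space borel (hyp \<theta>))"
proof (rule measurable_restrict_space2)
  show "hyp_isom e \<in> space (\<Pi>\<^sub>M i\<in>{..<CARD('n) - 1}. lborel) \<rightarrow> hyp \<theta>"
    using assms by (auto simp: hyp_isom_def hyp_def hyp_frame_def inner_sum_left)
  show "hyp_isom e \<in> borel_measurable (\<Pi>\<^sub>M i\<in>{..<CARD('n) - 1}. lborel)"
    unfolding hyp_isom_def[abs_def] by measurable
qed

lemma hyp_isom_bij:
  fixes \<theta> :: "real^'n"
  assumes "\<theta> \<in> sphere 0 1" and e: "hyp_frame \<theta> e"
  shows "bij_betw (hyp_isom e) ({..<CARD('n) - 1} \<rightarrow>\<^sub>E UNIV) (hyp \<theta>)"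
proof -
  let ?I = "{..<CARD('n) - 1}"
  have on: "e i \<bullet> e j = (if i = j then 1 else 0)" if "i \<in> ?I" "j \<in> ?I" for i j
    using e that by (auto simp: hyp_frame_def)
  have coord: "hyp_isom e x \<bullet> e j = x j" if "j \<in> ?I" for x j
    using inner_hyp_isom_frame[OF e] that by simp
  have inj: "inj_on (hyp_isom e) (?I \<rightarrow>\<^sub>E UNIV)"
  proof (rule inj_onI)
    fix x y assume xy: "x \<in> ?I \<rightarrow>\<^sub>E UNIV" "y \<in> ?I \<rightarrow>\<^sub>E UNIV" "hyp_isom e x = hyp_isom e y"
    have "x i = y i" if "i \<in> ?I" for i
      using coord[OF that, of x] coord[OF that, of y] xy(3) by simp
    then show "x = y" by (rule PiE_ext[OF xy(1,2)])
  qed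
  have into: "hyp_isom e x \<in> hyp \<theta>" for x
    using e by (auto simp: hyp_isom_def hyp_def hyp_frame_def inner_sum_left)
  have "inj_on e ?I"
  proof (rule inj_onI)
    fix i j assume "i \<in> ?I" "j \<in> ?I" "e i = e j"
    then show "i = j" using on[of i j] on[of i i] by (simp split: if_splits)
  qed
  then have card: "card (e ` ?I) = CARD('n) - 1"
    by (simp add: card_image)
  have "pairwise orthogonal (e ` ?I)"
    using on by (auto simp: pairwise_def orthogonal_def)
  moreover have "0 \<notin> e ` ?I"
  proof
    assume "0 \<in> e ` ?I"
    then obtain i where "i \<in> ?I" "e i = 0" by auto
    then show False using on[of i i] by simp
  qed
  ultimately have ind: "independent (e ` ?I)" by (rule pairwise_orthogonal_independent)
  have sub: "e ` ?I \<subseteq> hyp \<theta>" using e by (auto simp: hyp_frame_def)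
  have "\<theta> \<noteq> 0" using assms by auto
  have hyp_eq: "hyp \<theta> = {x. \<theta> \<bullet> x = 0}"
    by (simp add: hyp_def inner_commute)
  have dim: "dim (hyp \<theta>) = CARD('n) - 1"
    unfolding hyp_eq using dim_hyperplane[OF \<open>\<theta> \<noteq> 0\<close>] by simp
  have span: "hyp \<theta> \<subseteq> span (e ` ?I)"
    using card_ge_dim_independent[OF sub ind] card dim by simp
  have "v \<in> hyp_isom e ` (?I \<rightarrow>\<^sub>E UNIV)" if "v \<in> hyp \<theta>" for v
  proof -
    have "v \<in> span (e ` ?I)" using that span by blast
    then obtain u where "v = (\<Sum>w\<in>e ` ?I. u w *\<^sub>R w)"
      by (auto simp: span_finite)
    also have "\<dots> = (\<Sum>i\<in>?I. u (e i) *\<^sub>R e i)"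
      using \<open>inj_on e ?I\<close> by (simp add: sum.reindex)
    also have "\<dots> = hyp_isom e (restrict (\<lambda>i. u (e i)) ?I)"
      by (simp add: hyp_isom_def)
    finally show ?thesis by auto
  qed
  then show ?thesis using inj into by (auto simp: bij_betw_def)
qed

lemma dir_dist_bdd:
  fixes \<theta> :: "real^'n"
  assumes "bounded \<Omega>" and "\<theta> \<in> sphere 0 1"
  shows "bdd_above {s. 0 \<le> s \<and> (\<forall>t\<in>{0..<s}. x + t *\<^sub>R \<theta> \<in> \<Omega>)}"
proof -
  obtain K where K: "\<And>y. y \<in> \<Omega> \<Longrightarrow> norm y \<le> K"
    using assms(1) by (auto simp: bounded_iff)
  have "s \<le> \<bar>K\<bar> + norm x + 1" if s: "\<forall>t\<in>{0..<s}. x + t *\<^sub>R \<theta> \<in> \<Omega>" for s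
  proof (rule ccontr)
    assume "\<not> ?thesis"
    then have "x + (\<bar>K\<bar> + norm x + 1) *\<^sub>R \<theta> \<in> \<Omega>" using s by auto
    then have "norm (x + (\<bar>K\<bar> + norm x + 1) *\<^sub>R \<theta>) \<le> K" by (rule K)
    moreover have "norm ((\<bar>K\<bar> + norm x + 1) *\<^sub>R \<theta>) = \<bar>K\<bar> + norm x + 1"
      using assms(2) norm_ge_zero[of x] by simp
    moreover have "norm ((\<bar>K\<bar> + norm x + 1) *\<^sub>R \<theta>) - norm x
        \<le> norm (x + (\<bar>K\<bar> + norm x + 1) *\<^sub>R \<theta>)"
      using norm_triangle_ineq2[of "(\<bar>K\<bar> + norm x + 1) *\<^sub>R \<theta>" "- x"]
      by (simp only: norm_minus_cancel diff_minus_eq_add add.commute)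
    ultimately show False by linarith
  qed
  then show ?thesis by (intro bdd_aboveI) blast
qed

lemma dir_dist_greater_iff:
  fixes \<theta> :: "real^'n"
  assumes "open \<Omega>" and "bounded \<Omega>" and "\<theta> \<in> sphere 0 1" and "x \<in> \<Omega>" and "0 \<le> c"
  shows "c < dir_dist \<Omega> \<theta> x \<longleftrightarrow> (\<forall>t\<in>{0..c}. x + t *\<^sub>R \<theta> \<in> \<Omega>)"
proof -
  let ?S = "{s. 0 \<le> s \<and> (\<forall>t\<in>{0..<s}. x + t *\<^sub>R \<theta> \<in> \<Omega>)}"
  have ne: "?S \<noteq> {}" by (auto intro!: exI[of _ 0])
  have bdd: "bdd_above ?S" by (rule dir_dist_bdd) fact+
  have "c < dir_dist \<Omega> \<theta> x \<longleftrightarrow> (\<exists>s\<in>?S. c < s)"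
    unfolding dir_dist_def by (rule less_cSup_iff[OF ne bdd])
  also have "\<dots> \<longleftrightarrow> (\<forall>t\<in>{0..c}. x + t *\<^sub>R \<theta> \<in> \<Omega>)"
  proof
    assume R: "\<forall>t\<in>{0..c}. x + t *\<^sub>R \<theta> \<in> \<Omega>"
    have "open ((\<lambda>t. x + t *\<^sub>R \<theta>) -` \<Omega>)"
      by (intro open_vimage assms continuous_intros)
    moreover have "c \<in> (\<lambda>t. x + t *\<^sub>R \<theta>) -` \<Omega>" using R assms(5) by auto
    ultimately obtain r where r: "r > 0" "ball c r \<subseteq> (\<lambda>t. x + t *\<^sub>R \<theta>) -` \<Omega>"
      using open_contains_ball by blast
    have "x + t *\<^sub>R \<theta> \<in> \<Omega>" if "0 \<le> t" "t < c + r" for t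
    proof (cases "t \<le> c")
      case False
      then have "t \<in> ball c r" using that by (simp add: dist_real_def)
      then show ?thesis using r(2) by auto
    qed (use R that in auto)
    then have "c + r \<in> ?S" using r(1) assms(5) by auto
    then show "\<exists>s\<in>?S. c < s" using r(1) by force
  qed auto
  finally show ?thesis .
qed

lemma dir_dist_pos:
  fixes \<theta> :: "real^'n"
  assumes "open \<Omega>" and "bounded \<Omega>" and "\<theta> \<in> sphere 0 1" and "x \<in> \<Omega>"
  shows "0 < dir_dist \<Omega> \<theta> x"
  using dir_dist_greater_iff[OF assms, of 0] assms(4) by simp

lemma dir_exit_in_bdry:
  fixes \<theta> :: "real^'n"
  assumes "open \<Omega>" and "bounded \<Omega>" and "\<theta> \<in> sphere 0 1" and "x \<in> \<Omega>"
  shows "dir_exit \<Omega> \<theta> x \<in> bdry \<Omega>"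
proof -
  let ?d = "dir_dist \<Omega> \<theta> x"
  have d: "0 < ?d" by (rule dir_dist_pos) fact+
  have in_seg: "x + t *\<^sub>R \<theta> \<in> \<Omega>" if "0 \<le> t" "t < ?d" for t
    using dir_dist_greater_iff[OF assms that(1)] that by auto
  have "x + ?d *\<^sub>R \<theta> \<notin> \<Omega>"
  proof
    assume "x + ?d *\<^sub>R \<theta> \<in> \<Omega>"
    then have "\<forall>t\<in>{0..?d}. x + t *\<^sub>R \<theta> \<in> \<Omega>"
      using in_seg by (metis atLeastAtMost_iff less_eq_real_def)
    then have "?d < ?d" using dir_dist_greater_iff[OF assms, of ?d] d by simp
    then show False by simp
  qed
  moreover have "x + ?d *\<^sub>R \<theta> \<in> closure \<Omega>"
  proof (rule Lim_in_closed_set[of "closure \<Omega>" "\<lambda>t. x + t *\<^sub>R \<theta>" "at_left ?d"])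
    have "eventually (\<lambda>t. t \<in> {0<..<?d}) (at_left ?d)"
      using d by (rule eventually_at_left_real)
    then show "eventually (\<lambda>t. x + t *\<^sub>R \<theta> \<in> closure \<Omega>) (at_left ?d)"
      by eventually_elim (use in_seg closure_subset in force)
    show "((\<lambda>t. x + t *\<^sub>R \<theta>) \<longlongrightarrow> x + ?d *\<^sub>R \<theta>) (at_left ?d)"
      by (intro tendsto_intros)
  qed auto
  ultimately show ?thesis by (simp add: bdry_def dir_exit_def)
qed

lemma dir_exit_measurable:
  fixes \<theta> :: "real^'n"
  assumes "open \<Omega>" and "bounded \<Omega>" and "\<theta> \<in> sphere 0 1"
  shows "dir_exit \<Omega> \<theta> \<in> borel_measurable (restrict_space borel \<Omega>)"
proof -
  have "dir_dist \<Omega> \<theta> \<in> borel_measurable (restrict_space borel \<Omega>)"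
  proof (rule borel_measurableI_greater)
    fix c :: real
    have "{x \<in> \<Omega>. c < dir_dist \<Omega> \<theta> x} \<in> sets borel"
    proof (cases "0 \<le> c")
      case True
      let ?D = "\<Union>y\<in>- \<Omega>. \<Union>v\<in>(\<lambda>t. t *\<^sub>R \<theta>) ` {0..c}. {y - v}"
      have "compact ((\<lambda>t. t *\<^sub>R \<theta>) ` {0..c})"
        by (intro compact_continuous_image continuous_intros) auto
      then have "closed ?D"
        using assms(1) by (intro closed_compact_differences) auto
      moreover have "{x \<in> \<Omega>. c < dir_dist \<Omega> \<theta> x} = \<Omega> - ?D"
      proof (intro set_eqI)
        fix x
        have "x \<in> ?D \<longleftrightarrow> (\<exists>t\<in>{0..c}. x + t *\<^sub>R \<theta> \<notin> \<Omega>)"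
        proof
          assume "\<exists>t\<in>{0..c}. x + t *\<^sub>R \<theta> \<notin> \<Omega>"
          then obtain t where t: "t \<in> {0..c}" "x + t *\<^sub>R \<theta> \<in> - \<Omega>" by auto
          have "x \<in> {x + t *\<^sub>R \<theta> - t *\<^sub>R \<theta>}" by simp
          then show "x \<in> ?D" using t by blast
        next
          assume "x \<in> ?D"
          then obtain y t where "y \<notin> \<Omega>" "t \<in> {0..c}" "x = y - t *\<^sub>R \<theta>" by auto
          then show "\<exists>t\<in>{0..c}. x + t *\<^sub>R \<theta> \<notin> \<Omega>" by (intro bexI[of _ t]) auto
        qed
        then show "x \<in> {x \<in> \<Omega>. c < dir_dist \<Omega> \<theta> x} \<longleftrightarrow> x \<in> \<Omega> - ?D"
          using dir_dist_greater_iff[OF assms _ True, of x] by blast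
      qed
      ultimately show ?thesis using assms(1) by auto
    next
      case False
      then have "{x \<in> \<Omega>. c < dir_dist \<Omega> \<theta> x} = \<Omega>"
        using dir_dist_pos[OF assms] by force
      then show ?thesis using assms(1) by simp
    qed
    moreover have "\<Omega> \<in> sets borel" using assms(1) by simp
    ultimately show "{x \<in> space (restrict_space borel \<Omega>). c < dir_dist \<Omega> \<theta> x}
        \<in> sets (restrict_space borel \<Omega>)"
      by (auto simp: space_restrict_space sets_restrict_space_iff)
  qed
  moreover have "(\<lambda>x. x) \<in> borel_measurable (restrict_space borel \<Omega>)"
    by (rule measurable_restrict_space1) simp
  ultimately show ?thesis
    unfolding dir_exit_def[abs_def] by (intro borel_measurable_add borel_measurable_scaleR) auto
qed

lemma emeasure_dir_measure:
  fixes \<theta> :: "real^'n"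
  assumes "open \<Omega>" and "bounded \<Omega>" and "\<theta> \<in> sphere 0 1"
    and A: "A \<in> sets (restrict_space borel (bdry \<Omega>))"
  shows "emeasure (dir_measure \<Omega> \<theta>) A = (\<integral>\<^sup>+x\<in>\<Omega>. indicator A (dir_exit \<Omega> \<theta> x) \<partial>lborel)"
proof -
  let ?R = "restrict_space borel (bdry \<Omega>)" and ?L = "restrict_space lborel \<Omega>"
  let ?\<mu> = "\<lambda>A. \<integral>\<^sup>+x\<in>\<Omega>. indicator A (dir_exit \<Omega> \<theta> x) \<partial>lborel"
  let ?D = "distr ?L ?R (dir_exit \<Omega> \<theta>)"
  have \<Omega>: "\<Omega> \<in> sets lborel" using assms(1) by simp
  have "dir_exit \<Omega> \<theta> \<in> borel_measurable ?L"
    using dir_exit_measurable[OF assms(1-3)]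
    by (simp cong: measurable_cong_sets add: sets_restrict_space)
  then have meas: "dir_exit \<Omega> \<theta> \<in> measurable ?L ?R"
    using dir_exit_in_bdry[OF assms(1-3)]
    by (intro measurable_restrict_space2) (auto simp: space_restrict_space)
  have eq: "emeasure ?D B = ?\<mu> B" if B: "B \<in> sets ?R" for B
  proof -
    have "emeasure ?D B = (\<integral>\<^sup>+x. indicator B x \<partial>?D)" using B by simp
    also have "\<dots> = (\<integral>\<^sup>+x. indicator B (dir_exit \<Omega> \<theta> x) \<partial>?L)"
      using B by (intro nn_integral_distr meas) auto
    also have "\<dots> = ?\<mu> B"
      using \<Omega> by (subst nn_integral_restrict_space) auto
    finally show ?thesis .
  qed
  have sp: "space ?R = bdry \<Omega>" by (simp add: space_restrict_space)
  show ?thesis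
  proof (rule emeasure_measure_of[OF dir_measure_def])
    show "sets ?R \<subseteq> Pow (bdry \<Omega>)" using sets.space_closed[of ?R] sp by simp
    have sets_D: "sets (dir_measure \<Omega> \<theta>) = sets ?R"
      using sets.sigma_sets_eq[of ?R] sets.space_closed[of ?R] sp
      by (simp add: dir_measure_def)
    show "A \<in> sets (dir_measure \<Omega> \<theta>)" using A sets_D by simp
    show "positive (sets (dir_measure \<Omega> \<theta>)) ?\<mu>" by (simp add: positive_def)
    have "countably_additive (sets ?R) (emeasure ?D)"
      using emeasure_countably_additive[of ?D] by simp
    then show "countably_additive (sets (dir_measure \<Omega> \<theta>)) ?\<mu>"
      unfolding sets_D countably_additive_def by (simp add: eq image_subset_iff)
  qed
qed

end

theory Submission
  imports Defs
begin

text \<open>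
  Let \<open>U\<close> be the set of points of \<open>\<Omega>\<close> whose exit point lies in \<open>A\<close>, so that the directional
  measure of \<open>A\<close> is the volume of \<open>U\<close>. Each line parallel to \<open>\<theta>\<close> that meets \<open>U\<close> meets it in a
  set of positive length, since all points between a point and its exit point share that exit
  point. Hence the projection of \<open>A\<close> consists of exactly those \<open>p\<close> in the hyperplane for which the
  line through \<open>p\<close> meets \<open>U\<close> in positive length. This makes the projection a Borel set without any
  appeal to analytic sets, and the equivalence becomes Fubini's theorem for null sets.
\<close>

section \<open>Lebesgue measure in orthonormal coordinates and Fubini along \<theta>\<close>

lemma inner_bij_betw_Basis:
  assumes "bij_betw b I Basis" and "i \<in> I" and "j \<in> I"
  shows "b i \<bullet> b j = (if i = j then 1 else 0)"
proof -
  have "b i \<in> Basis" "b j \<in> Basis" using assms by (blast dest: bij_betwE)+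
  moreover have "b i = b j \<longleftrightarrow> i = j"
    using assms by (auto simp: bij_betw_def dest: inj_onD)
  ultimately show ?thesis by (simp add: inner_Basis)
qed

text \<open>Lebesgue measure is determined by its values on boxes, and the coordinate map pulls a
  box back to a product of intervals. The index set is left free so that it can be an initial
  segment of the naturals, from which one coordinate is split off below.\<close>

lemma lborel_eq_distr_PiM:
  fixes b :: "'i \<Rightarrow> 'a::euclidean_space"
  assumes b: "bij_betw b I Basis"
  shows "lborel = distr (\<Pi>\<^sub>M i\<in>I. lborel) borel (\<lambda>x. \<Sum>i\<in>I. x i *\<^sub>R b i)" (is "_ = distr ?P _ ?f")
proof (rule lborel_eqI)
  interpret product_sigma_finite "\<lambda>_::'i. lborel :: real measure" ..
  have fin: "finite I" using b by (simp add: bij_betw_finite)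
  have meas: "?f \<in> borel_measurable ?P" by measurable
  have coord: "?f x \<bullet> b j = x j" if "j \<in> I" for x j
  proof -
    have "?f x \<bullet> b j = (\<Sum>i\<in>I. if i = j then x i else 0)"
      unfolding inner_sum_left using that
      by (intro sum.cong refl) (simp add: inner_bij_betw_Basis[OF b])
    then show ?thesis using that fin by simp
  qed
  fix l u :: 'a assume le: "\<And>b. b \<in> Basis \<Longrightarrow> l \<bullet> b \<le> u \<bullet> b"
  have "?f -` box l u \<inter> space ?P = (\<Pi>\<^sub>E i\<in>I. {l \<bullet> b i<..<u \<bullet> b i})"
  proof (intro set_eqI)
    fix x
    have "?f x \<in> box l u \<longleftrightarrow> (\<forall>i\<in>I. l \<bullet> b i < x i \<and> x i < u \<bullet> b i)"
      unfolding mem_box bij_betw_imp_surj_on[OF b, symmetric] by (simp add: coord)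
    then show "x \<in> ?f -` box l u \<inter> space ?P \<longleftrightarrow> x \<in> (\<Pi>\<^sub>E i\<in>I. {l \<bullet> b i<..<u \<bullet> b i})"
      by (auto simp: space_PiM PiE_iff)
  qed
  then have "emeasure (distr ?P borel ?f) (box l u) = emeasure ?P (\<Pi>\<^sub>E i\<in>I. {l \<bullet> b i<..<u \<bullet> b i})"
    by (simp add: emeasure_distr[OF meas])
  also have "\<dots> = (\<Prod>i\<in>I. ennreal ((u - l) \<bullet> b i))"
  proof (subst emeasure_PiM[OF fin])
    have "b i \<in> Basis" if "i \<in> I" for i using b that by (auto simp: bij_betw_def)
    then show "(\<Prod>i\<in>I. emeasure lborel {l \<bullet> b i<..<u \<bullet> b i}) = (\<Prod>i\<in>I. ennreal ((u - l) \<bullet> b i))"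
      using le by (intro prod.cong refl) (simp add: inner_diff_left)
  qed simp
  also have "\<dots> = (\<Prod>c\<in>Basis. ennreal ((u - l) \<bullet> c))"
    by (rule prod.reindex_bij_betw[OF b])
  also have "\<dots> = ennreal (\<Prod>c\<in>Basis. (u - l) \<bullet> c)"
    using le by (intro prod_ennreal) (simp add: inner_diff_left)
  finally show "emeasure (distr ?P borel ?f) (box l u) = (\<Prod>c\<in>Basis. (u - l) \<bullet> c)" .
qed simp

text \<open>\<open>T\<close> and its inverse are linear, hence differentiable, and a differentiable
  map of the space into itself sends negligible sets to negligible sets.\<close>

lemma emeasure_lborel_linear_vimage_eq_0_iff:
  fixes T :: "'a::euclidean_space \<Rightarrow> 'a"
  assumes "linear T" and "inj T" and "U \<in> sets borel"
  shows "emeasure lborel (T -` U) = 0 \<longleftrightarrow> emeasure lborel U = 0"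
proof -
  have "T \<in> borel_measurable borel"
    using assms(1) by (intro borel_measurable_continuous_onI linear_continuous_on linear_linear[THEN iffD2])
  then have "T -` U \<in> sets borel" using assms(3) by (rule measurable_sets_borel)
  have neg: "emeasure lborel X = 0 \<longleftrightarrow> negligible X" if "X \<in> sets borel" for X :: "'a set"
    using that by (simp add: negligible_iff_null_sets null_sets_completion_iff null_sets_def)
  have image: "negligible (f ` X)" if "linear f" "negligible X" for f :: "'a \<Rightarrow> 'a" and X
    using that by (intro negligible_differentiable_image_negligible linear_imp_differentiable_on) auto
  obtain g where g: "linear g" "\<And>x. g (T x) = x" "\<And>x. T (g x) = x"
    using linear_injective_isomorphism[OF assms(1,2)] by auto
  then have "T ` (T -` U) = U" and "g ` U = T -` U"
    by (auto simp: image_iff) metis+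
  then have "negligible U \<longleftrightarrow> negligible (T -` U)"
    using image[OF assms(1), of "T -` U"] image[OF g(1), of U] by auto
  then show ?thesis using neg assms(3) \<open>T -` U \<in> sets borel\<close> by simp
qed

text \<open>Fubini's theorem in coordinates adapted to \<theta>: a linear bijection carries the
  standard basis to the frame completed by \<theta>, so that the innermost integration runs along
  lines parallel to \<theta>.\<close>

lemma emeasure_lborel_eq_0_iff_AE_lines:
  fixes \<theta> :: "real^'n"
  assumes \<theta>: "\<theta> \<in> sphere 0 1" and e: "hyp_frame \<theta> e" and U: "U \<in> sets borel"
  shows "emeasure lborel U = 0 \<longleftrightarrow>
    (AE y in \<Pi>\<^sub>M i\<in>{..<CARD('n) - 1}. lborel. emeasure lborel {t. hyp_isom e y + t *\<^sub>R \<theta> \<in> U} = 0)"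
proof -
  interpret product_sigma_finite "\<lambda>_::nat. lborel :: real measure" ..
  define m where "m = CARD('n) - 1"
  \<comment> \<open>The dimension is positive, so the subtraction on naturals is not truncated. In
    dimension one \<open>m\<close> is 0 and the product over the empty index set is a single
    point.\<close>
  have card: "CARD('n) = Suc m" using zero_less_card_finite[where 'a='n] by (simp add: m_def)
  have ins: "{..<Suc m} = insert m {..<m}" by auto
  have "card {..<Suc m} = card (Basis :: (real^'n) set)"
    by (simp only: card_lessThan card[symmetric] DIM_cart DIM_real mult_1_right)
  then obtain b where b: "bij_betw b {..<Suc m} (Basis :: (real^'n) set)"
    using bij_betw_iff_card[of "{..<Suc m}" "Basis :: (real^'n) set"] by auto
  \<comment> \<open>\<open>hyp_frame\<close> constrains \<open>e\<close> only below
    \<open>m\<close>, so index \<open>m\<close> is free to hold \<theta>. The family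
    \<open>f\<close> is then an orthonormal basis of the whole space.\<close>
  define f where "f = e(m := \<theta>)"
  have f: "f i \<bullet> f j = (if i = j then 1 else 0)" if "i < Suc m" "j < Suc m" for i j
    using e that \<theta> unfolding hyp_frame_def hyp_def m_def[symmetric] f_def
    by (auto simp: less_Suc_eq inner_commute norm_eq_1)
  define T where "T v = (\<Sum>i<Suc m. (v \<bullet> b i) *\<^sub>R f i)" for v
  have lin: "linear T"
    unfolding T_def
    by (intro linear_compose_sum ballI linearI) (auto simp: inner_add_left scaleR_add_left)
  have Tf: "T v \<bullet> f j = v \<bullet> b j" if "j < Suc m" for v j
  proof -
    have "T v \<bullet> f j = (\<Sum>i\<in>{..<Suc m}. if i = j then v \<bullet> b i else 0)"
      unfolding T_def inner_sum_left using that f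
      by (intro sum.cong refl) auto
    then show ?thesis using that by simp
  qed
  \<comment> \<open>By orthonormality of \<open>f\<close>, the vector \<open>T v\<close> determines
    all coordinates of \<open>v\<close>.\<close>
  have inj: "inj T"
  proof (rule linear_injective_0[OF lin, THEN iffD2], intro allI impI)
    fix v assume "T v = 0"
    then have "v \<bullet> b j = 0" if "j < Suc m" for j using Tf[OF that, of v] by simp
    then have "\<forall>c\<in>b ` {..<Suc m}. v \<bullet> c = 0" by blast
    then show "v = 0"
      unfolding bij_betw_imp_surj_on[OF b] by (simp add: euclidean_all_zero_iff)
  qed
  have Tb: "T (b i) = f i" if "i < Suc m" for i
  proof -
    have "T (b i) = (\<Sum>j<Suc m. if j = i then f j else 0)"
      unfolding T_def using that
      by (intro sum.cong refl) (simp add: inner_bij_betw_Basis[OF b])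
    then show ?thesis using that by simp
  qed
  have "T \<in> borel_measurable borel"
    using lin by (intro borel_measurable_continuous_onI linear_continuous_on linear_linear[THEN iffD2])
  then have TU: "T -` U \<in> sets borel" using U by (rule measurable_sets_borel)
  let ?P = "\<lambda>I. Pi\<^sub>M I (\<lambda>_::nat. lborel :: real measure)"
  let ?s = "\<lambda>x. \<Sum>i<Suc m. x i *\<^sub>R b i"
  \<comment> \<open>The first \<open>m\<close> coordinates give the foot of a line in the
    hyperplane, and the last one is the parameter along \<theta>.\<close>
  have Ts: "T (?s (y(m := t))) = hyp_isom e y + t *\<^sub>R \<theta>" for y t
  proof -
    have "T (?s (y(m := t))) = (\<Sum>i<Suc m. (y(m := t)) i *\<^sub>R f i)"
      using Tb by (simp add: linear_sum[OF lin] linear_cmul[OF lin] linear_add[OF lin])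
    also have "\<dots> = (\<Sum>i<m. y i *\<^sub>R e i) + t *\<^sub>R \<theta>"
      by (simp add: f_def)
    finally show ?thesis by (simp add: hyp_isom_def m_def)
  qed
  have isom: "hyp_isom e \<in> borel_measurable (?P {..<m})"
    unfolding hyp_isom_def[abs_def] m_def by measurable
  have pair: "(\<lambda>(y, t). indicator U (hyp_isom e y + t *\<^sub>R \<theta>) :: ennreal)
      \<in> borel_measurable (?P {..<m} \<Otimes>\<^sub>M lborel)"
    using isom U by measurable
  have s: "?s \<in> borel_measurable (?P {..<Suc m})" by measurable
  have "emeasure lborel U = 0 \<longleftrightarrow> emeasure lborel (T -` U) = 0"
    using emeasure_lborel_linear_vimage_eq_0_iff[OF lin inj U] by simp
  also have "emeasure lborel (T -` U) = (\<integral>\<^sup>+x. indicator (T -` U) x \<partial>lborel)"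
    using TU by simp
  also have "\<dots> = (\<integral>\<^sup>+x. indicator (T -` U) (?s x) \<partial>?P {..<Suc m})"
    using TU by (subst lborel_eq_distr_PiM[OF b], intro nn_integral_distr s) auto
  also have "\<dots> = (\<integral>\<^sup>+y. (\<integral>\<^sup>+t. indicator (T -` U) (?s (y(m := t))) \<partial>lborel) \<partial>?P {..<m})"
    unfolding ins
  proof (rule product_nn_integral_insert)
    show "(\<lambda>x. indicator (T -` U) (\<Sum>i\<in>insert m {..<m}. x i *\<^sub>R b i) :: ennreal)
        \<in> borel_measurable (?P (insert m {..<m}))"
      using TU by measurable
  qed auto
  also have "\<dots> = (\<integral>\<^sup>+y. (\<integral>\<^sup>+t. indicator U (hyp_isom e y + t *\<^sub>R \<theta>) \<partial>lborel) \<partial>?P {..<m})"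
    by (simp only: indicator_vimage o_def Ts)
  also have "\<dots> = 0 \<longleftrightarrow> (AE y in ?P {..<m}. (\<integral>\<^sup>+t. indicator U (hyp_isom e y + t *\<^sub>R \<theta>) \<partial>lborel) = 0)"
    using pair by (intro nn_integral_0_iff_AE sigma_finite_measure.borel_measurable_nn_integral lborel.sigma_finite_measure_axioms)
  also have "(\<lambda>y. \<integral>\<^sup>+t. indicator U (hyp_isom e y + t *\<^sub>R \<theta>) \<partial>lborel)
      = (\<lambda>y. emeasure lborel {t. hyp_isom e y + t *\<^sub>R \<theta> \<in> U})"
  proof
    fix y
    have "(\<lambda>t. hyp_isom e y + t *\<^sub>R \<theta>) \<in> borel_measurable borel" by measurable
    then have "(\<lambda>t. hyp_isom e y + t *\<^sub>R \<theta>) -` U \<in> sets borel" using U by (rule measurable_sets_borel)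
    then have "(\<integral>\<^sup>+t. indicator ((\<lambda>t. hyp_isom e y + t *\<^sub>R \<theta>) -` U) t \<partial>lborel)
        = emeasure lborel ((\<lambda>t. hyp_isom e y + t *\<^sub>R \<theta>) -` U)"
      by simp
    then show "(\<integral>\<^sup>+t. indicator U (hyp_isom e y + t *\<^sub>R \<theta>) \<partial>lborel)
        = emeasure lborel {t. hyp_isom e y + t *\<^sub>R \<theta> \<in> U}"
      by (simp only: indicator_vimage) (simp only: vimage_def)
  qed
  finally show ?thesis unfolding m_def .
qed

text \<open>The almost-everywhere statement about lines is carried from coordinates to the
  hyperplane by \<open>hyp_isom e\<close>. The exceptional set is Borel in the hyperplane, so
  passing to the completion does not change its measure.\<close>

lemma emeasure_lborel_eq_0_iff_hyp_lebesgue: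
  fixes \<theta> :: "real^'n"
  assumes \<theta>: "\<theta> \<in> sphere 0 1" and e: "hyp_frame \<theta> e" and U: "U \<in> sets borel"
  shows "emeasure lborel U = 0 \<longleftrightarrow>
    emeasure (hyp_lebesgue \<theta> e) {p \<in> hyp \<theta>. 0 < emeasure lborel {t. p + t *\<^sub>R \<theta> \<in> U}} = 0"
proof -
  let ?P = "\<Pi>\<^sub>M i\<in>{..<CARD('n) - 1}. (lborel :: real measure)"
  let ?R = "restrict_space borel (hyp \<theta>)"
  let ?g = "\<lambda>p. emeasure lborel {t. p + t *\<^sub>R \<theta> \<in> U}"
  let ?Q = "{p \<in> hyp \<theta>. 0 < ?g p}"
  \<comment> \<open>The sets of parameters \<open>t\<close> are the sections of one measurable set
    of pairs, so their measure depends measurably on \<open>p\<close>.\<close>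
  have "{x \<in> space (borel \<Otimes>\<^sub>M lborel). fst x + snd x *\<^sub>R \<theta> \<in> U} \<in> sets (borel \<Otimes>\<^sub>M (lborel :: real measure))"
    using U by measurable
  then have "?g \<in> borel_measurable borel"
    using lborel.measurable_emeasure_Pair[of "{x. fst x + snd x *\<^sub>R \<theta> \<in> U}" borel]
    by (simp add: space_pair_measure vimage_def)
  then have "{p. 0 < ?g p} \<in> sets borel" by measurable
  then have Q: "?Q \<in> sets ?R"
    by (auto simp: sets_restrict_space intro!: image_eqI[of _ _ "{p. 0 < ?g p}"])
  note isom = hyp_isom_measurable[OF e]
  have into: "hyp_isom e y \<in> hyp \<theta>" for y
    using e by (auto simp: hyp_isom_def hyp_def hyp_frame_def inner_sum_left)
  have "emeasure (hyp_lebesgue \<theta> e) ?Q = emeasure (distr ?P ?R (hyp_isom e)) ?Q"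
    using Q by (simp add: hyp_lebesgue_def main_part_sets)
  also have "\<dots> = emeasure ?P {y \<in> space ?P. hyp_isom e y \<in> ?Q}"
    by (simp only: emeasure_distr[OF isom Q]) (simp only: vimage_def Int_def mem_Collect_eq conj_commute)
  also have "\<dots> = 0 \<longleftrightarrow> (AE y in ?P. hyp_isom e y \<notin> ?Q)"
    using measurable_sets[OF isom Q] by (intro AE_iff_measurable[symmetric]) (auto simp: vimage_def Int_def conj_commute zero_less_iff_neq_zero)
  also have "\<dots> \<longleftrightarrow> emeasure lborel U = 0"
    unfolding emeasure_lborel_eq_0_iff_AE_lines[OF assms] using into by simp
  finally show ?thesis by simp
qed

section \<open>Moving along \<theta>, and Borel measurability of the set of exit points\<close>

text \<open>The segment from \<open>x\<close> to \<open>x + s *\<^sub>R \<theta>\<close> already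
  lies in \<Omega>. Hence a further segment of length \<open>c\<close> stays in \<Omega> exactly if
  the segment of length \<open>s + c\<close> from \<open>x\<close> does.\<close>

lemma dir_dist_add:
  fixes \<theta> :: "real^'n"
  assumes \<Omega>: "open \<Omega>" "bounded \<Omega>" and \<theta>: "\<theta> \<in> sphere 0 1" and x: "x \<in> \<Omega>"
    and s: "0 \<le> s" "s < dir_dist \<Omega> \<theta> x"
  shows "x + s *\<^sub>R \<theta> \<in> \<Omega>" and "dir_dist \<Omega> \<theta> (x + s *\<^sub>R \<theta>) = dir_dist \<Omega> \<theta> x - s"
proof -
  have seg: "x + t *\<^sub>R \<theta> \<in> \<Omega>" if "0 \<le> t" "t \<le> s" for t
    using dir_dist_greater_iff[OF \<Omega> \<theta> x s(1)] s(2) that by simp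
  show y: "x + s *\<^sub>R \<theta> \<in> \<Omega>" using seg s(1) by simp
  have iff: "c < dir_dist \<Omega> \<theta> (x + s *\<^sub>R \<theta>) \<longleftrightarrow> c < dir_dist \<Omega> \<theta> x - s" if c: "0 \<le> c" for c
  proof -
    have "(\<forall>t\<in>{0..c}. (x + s *\<^sub>R \<theta>) + t *\<^sub>R \<theta> \<in> \<Omega>) \<longleftrightarrow> (\<forall>t\<in>{0..s + c}. x + t *\<^sub>R \<theta> \<in> \<Omega>)" (is "?L \<longleftrightarrow> ?R")
    proof
      assume L: ?L
      show ?R
      proof
        fix t assume t: "t \<in> {0..s + c}"
        show "x + t *\<^sub>R \<theta> \<in> \<Omega>"
        proof (cases "t \<le> s")
          case False
          then have "(x + s *\<^sub>R \<theta>) + (t - s) *\<^sub>R \<theta> \<in> \<Omega>" using L t by auto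
          then show ?thesis by (simp add: algebra_simps)
        qed (use seg t in auto)
      qed
    next
      assume R: ?R
      show ?L
      proof
        fix t assume "t \<in> {0..c}"
        then have "x + (s + t) *\<^sub>R \<theta> \<in> \<Omega>" using R s(1) by auto
        then show "(x + s *\<^sub>R \<theta>) + t *\<^sub>R \<theta> \<in> \<Omega>" by (simp add: algebra_simps)
      qed
    qed
    then show ?thesis
      using dir_dist_greater_iff[OF \<Omega> \<theta> y c] dir_dist_greater_iff[OF \<Omega> \<theta> x, of "s + c"] c s(1)
      by (simp add: less_diff_eq add.commute)
  qed
  \<comment> \<open>Both sides of the claimed equation are positive, so each may serve as the
    threshold \<open>c\<close> in \<open>iff\<close>. This excludes both strict inequalities between
    them.\<close>
  have "0 < dir_dist \<Omega> \<theta> (x + s *\<^sub>R \<theta>)" by (rule dir_dist_pos[OF \<Omega> \<theta> y])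
  then show "dir_dist \<Omega> \<theta> (x + s *\<^sub>R \<theta>) = dir_dist \<Omega> \<theta> x - s"
    using iff[of "dir_dist \<Omega> \<theta> (x + s *\<^sub>R \<theta>)"] iff[of "dir_dist \<Omega> \<theta> x - s"] s(2) by force
qed

lemma dir_exit_add:
  fixes \<theta> :: "real^'n"
  assumes "open \<Omega>" and "bounded \<Omega>" and "\<theta> \<in> sphere 0 1" and "x \<in> \<Omega>"
    and "0 \<le> s" and "s < dir_dist \<Omega> \<theta> x"
  shows "dir_exit \<Omega> \<theta> (x + s *\<^sub>R \<theta>) = dir_exit \<Omega> \<theta> x"
  by (simp add: dir_exit_def dir_dist_add(2)[OF assms] scaleR_diff_left)

lemma dir_exit_vimage_borel:
  fixes \<theta> :: "real^'n"
  assumes "open \<Omega>" and "bounded \<Omega>" and "\<theta> \<in> sphere 0 1" and "B \<in> sets borel"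
  shows "{x \<in> \<Omega>. dir_exit \<Omega> \<theta> x \<in> B} \<in> sets borel"
proof -
  have "\<Omega> \<in> sets borel" using assms(1) by simp
  then show ?thesis
    using measurable_sets[OF dir_exit_measurable[OF assms(1-3)] assms(4)]
    by (simp add: sets_restrict_space_iff space_restrict_space vimage_def Int_def conj_commute)
qed

text \<open>A Borel image need not be Borel, but membership can be tested by countably many Borel
  conditions: \<open>z\<close> is an exit point iff, for some \<open>k\<close>, the point at
  distance \<open>1 / (k + 1)\<close> behind \<open>z\<close> lies in \<Omega> and exits at
  \<open>z\<close>.\<close>

lemma dir_bdry_borel:
  fixes \<theta> :: "real^'n"
  assumes \<Omega>: "open \<Omega>" "bounded \<Omega>" and \<theta>: "\<theta> \<in> sphere 0 1"
  shows "dir_bdry \<Omega> \<theta> \<in> sets borel"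
proof -
  \<comment> \<open>The value 0 off \<Omega> extends the exit map to a Borel function on the whole
    space. It is harmless, as \<open>h\<close> is only compared with \<open>z\<close> when its
    argument lies in \<Omega>.\<close>
  define h where "h x = (if x \<in> \<Omega> then dir_exit \<Omega> \<theta> x else 0)" for x
  have h: "h \<in> borel_measurable borel"
    using dir_exit_measurable[OF assms] \<Omega>(1) unfolding h_def[abs_def]
    by (subst (asm) measurable_restrict_space_iff[where c=0]) auto
  let ?w = "\<lambda>k z. z - inverse (real (Suc k)) *\<^sub>R \<theta>"
  have "dir_bdry \<Omega> \<theta> = (\<Union>k. {z. ?w k z \<in> \<Omega> \<and> h (?w k z) = z})"
  proof (intro equalityI subsetI)
    fix z assume "z \<in> dir_bdry \<Omega> \<theta>"
    then obtain x where x: "x \<in> \<Omega>" "z = dir_exit \<Omega> \<theta> x" by (auto simp: dir_bdry_def)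
    let ?d = "dir_dist \<Omega> \<theta> x"
    have "0 < ?d" by (rule dir_dist_pos[OF assms x(1)])
    \<comment> \<open>A step back from \<open>z\<close> that is shorter than \<open>?d\<close> lands
      between \<open>x\<close> and \<open>z\<close>, where the exit point is still
      \<open>z\<close>.\<close>
    then obtain k where k: "inverse (real (Suc k)) < ?d" using reals_Archimedean by blast
    let ?s = "?d - inverse (real (Suc k))"
    have s: "0 \<le> ?s" "?s < ?d" using k by simp_all
    have "?w k z = x + ?s *\<^sub>R \<theta>" by (simp add: x(2) dir_exit_def algebra_simps)
    then show "z \<in> (\<Union>k. {z. ?w k z \<in> \<Omega> \<and> h (?w k z) = z})"
      using dir_dist_add(1)[OF assms x(1) s] dir_exit_add[OF assms x(1) s] x(2)
      by (intro UN_I[of k]) (simp_all add: h_def)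
  next
    fix z assume "z \<in> (\<Union>k. {z. ?w k z \<in> \<Omega> \<and> h (?w k z) = z})"
    then show "z \<in> dir_bdry \<Omega> \<theta>" by (auto simp: h_def dir_bdry_def intro: rev_image_eqI)
  qed
  moreover have "{z. ?w k z \<in> \<Omega> \<and> h (?w k z) = z} \<in> sets borel" for k
  proof -
    have "\<Omega> \<in> sets borel" using \<Omega>(1) by simp
    then show ?thesis using h by measurable
  qed
  ultimately show ?thesis by auto
qed

section \<open>Projection along \<theta> and the equivalence\<close>

lemma hyp_proj_add_scaleR:
  fixes \<theta> :: "real^'n"
  assumes "\<theta> \<in> sphere 0 1" and "p \<in> hyp \<theta>"
  shows "hyp_proj \<theta> (p + t *\<^sub>R \<theta>) = p"
  using assms by (simp add: hyp_proj_def hyp_def inner_add_left norm_eq_1)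

lemma hyp_proj_in_hyp:
  fixes \<theta> :: "real^'n"
  assumes "\<theta> \<in> sphere 0 1"
  shows "hyp_proj \<theta> x \<in> hyp \<theta>"
  using assms by (simp add: hyp_proj_def hyp_def inner_diff_left norm_eq_1)

lemma hyp_proj_image_eq:
  fixes \<theta> :: "real^'n"
  assumes \<Omega>: "open \<Omega>" "bounded \<Omega>" and \<theta>: "\<theta> \<in> sphere 0 1"
    and A: "A \<subseteq> dir_bdry \<Omega> \<theta>" "A \<in> sets borel"
  defines "U \<equiv> {x \<in> \<Omega>. dir_exit \<Omega> \<theta> x \<in> A}"
  shows "hyp_proj \<theta> ` A = {p \<in> hyp \<theta>. 0 < emeasure lborel {t. p + t *\<^sub>R \<theta> \<in> U}}"
proof (intro equalityI subsetI)
  fix p assume "p \<in> hyp_proj \<theta> ` A"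
  then obtain z where z: "z \<in> A" "p = hyp_proj \<theta> z" by auto
  then obtain x where x: "x \<in> \<Omega>" "z = dir_exit \<Omega> \<theta> x" using A by (auto simp: dir_bdry_def)
  let ?d = "dir_dist \<Omega> \<theta> x" and ?L = "{t. p + t *\<^sub>R \<theta> \<in> U}"
  \<comment> \<open>The parameter of \<open>x\<close> on the line through \<open>p\<close>: the
    point \<open>z\<close> has parameter \<open>z \<bullet> \<theta>\<close> and lies
    \<open>?d\<close> further along \<theta>.\<close>
  define c where "c = z \<bullet> \<theta> - ?d"
  have d: "0 < ?d" by (rule dir_dist_pos[OF \<Omega> \<theta> x(1)])
  have pc: "x = p + c *\<^sub>R \<theta>"
    using x(2) z(2) by (simp add: c_def hyp_proj_def dir_exit_def algebra_simps)
  \<comment> \<open>The half-open segment from \<open>x\<close> to \<open>z\<close> lies in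
    \<open>U\<close>, which gives the line length at least \<open>?d\<close> in
    \<open>U\<close>.\<close>
  have "{c..<c + ?d} \<subseteq> ?L"
  proof
    fix t assume "t \<in> {c..<c + ?d}"
    then have "0 \<le> t - c" "t - c < ?d" by auto
    then have "x + (t - c) *\<^sub>R \<theta> \<in> U"
      using dir_dist_add(1)[OF \<Omega> \<theta> x(1)] dir_exit_add[OF \<Omega> \<theta> x(1)] x(2) z(1)
      by (simp add: U_def)
    then show "t \<in> ?L" by (simp add: pc algebra_simps)
  qed
  moreover have "?L \<in> sets lborel"
  proof -
    have "U \<in> sets borel" unfolding U_def by (rule dir_exit_vimage_borel[OF \<Omega> \<theta> A(2)])
    then show ?thesis by measurable
  qed
  ultimately have "emeasure lborel {c..<c + ?d} \<le> emeasure lborel ?L" by (rule emeasure_mono)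
  then have "0 < emeasure lborel ?L" using d by (simp add: less_le_trans[OF ennreal_less_zero_iff[THEN iffD2]])
  then show "p \<in> {p \<in> hyp \<theta>. 0 < emeasure lborel {t. p + t *\<^sub>R \<theta> \<in> U}}"
    using hyp_proj_in_hyp[OF \<theta>] z(2) by simp
next
  fix p assume "p \<in> {p \<in> hyp \<theta>. 0 < emeasure lborel {t. p + t *\<^sub>R \<theta> \<in> U}}"
  \<comment> \<open>Positive measure is used only to find one point of \<open>U\<close> on the line.
    Its exit point lies on the same line and therefore projects to \<open>p\<close>.\<close>
  then have p: "p \<in> hyp \<theta>" and "{t. p + t *\<^sub>R \<theta> \<in> U} \<noteq> {}" by (auto simp del: Collect_empty_eq)
  then obtain t where "dir_exit \<Omega> \<theta> (p + t *\<^sub>R \<theta>) \<in> A" by (auto simp: U_def)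
  moreover have "hyp_proj \<theta> (dir_exit \<Omega> \<theta> (p + t *\<^sub>R \<theta>)) = p"
    using hyp_proj_add_scaleR[OF \<theta> p] by (simp add: dir_exit_def add.assoc flip: scaleR_add_left)
  ultimately show "p \<in> hyp_proj \<theta> ` A" by (metis imageI)
qed

theorem lemma2p6:
  fixes \<Omega> :: "(real^'n) set" and \<theta> :: "real^'n" and A :: "(real^'n) set"
    and e :: "nat \<Rightarrow> real^'n"
  assumes "open \<Omega>" and "bounded \<Omega>" and "\<Omega> \<noteq> {}"
    and "\<theta> \<in> sphere 0 1"
    and "hyp_frame \<theta> e"
    and "A \<in> sets (restrict_space borel (dir_bdry \<Omega> \<theta>))" and "A \<noteq> {}"
  shows "emeasure (dir_measure \<Omega> \<theta>) A > 0 \<longleftrightarrow>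
         emeasure (hyp_lebesgue \<theta> e) (hyp_proj \<theta> ` A) > 0"
proof -
  define U where "U = {x \<in> \<Omega>. dir_exit \<Omega> \<theta> x \<in> A}"
  \<comment> \<open>Since \<open>dir_bdry \<Omega> \<theta>\<close> is itself Borel, its relative
    Borel sets are Borel in the whole space, and hence also relative Borel sets of
    \<open>bdry \<Omega>\<close>, where the directional measure lives.\<close>
  have A: "A \<in> sets borel" "A \<subseteq> dir_bdry \<Omega> \<theta>"
    using assms(6) dir_bdry_borel[OF assms(1,2,4)] by (auto simp: sets_restrict_space_iff)
  have sub: "dir_bdry \<Omega> \<theta> \<subseteq> bdry \<Omega>"
    using dir_exit_in_bdry[OF assms(1,2,4)] by (auto simp: dir_bdry_def)
  have "A = bdry \<Omega> \<inter> A" using A(2) sub by auto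
  then have "A \<in> sets (restrict_space borel (bdry \<Omega>))"
    using A(1) unfolding sets_restrict_space by (rule image_eqI)
  then have "emeasure (dir_measure \<Omega> \<theta>) A = (\<integral>\<^sup>+x\<in>\<Omega>. indicator A (dir_exit \<Omega> \<theta> x) \<partial>lborel)"
    by (rule emeasure_dir_measure[OF assms(1,2,4)])
  also have "\<dots> = (\<integral>\<^sup>+x. indicator U x \<partial>lborel)"
    by (intro nn_integral_cong) (auto simp: U_def indicator_def)
  also have U: "U \<in> sets borel"
    unfolding U_def by (rule dir_exit_vimage_borel[OF assms(1,2,4) A(1)])
  then have "(\<integral>\<^sup>+x. indicator U x \<partial>lborel) = emeasure lborel U" by simp
  finally have "emeasure (dir_measure \<Omega> \<theta>) A = emeasure lborel U" .
  moreover have "emeasure lborel U = 0 \<longleftrightarrow> emeasure (hyp_lebesgue \<theta> e) (hyp_proj \<theta> ` A) = 0"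
    unfolding hyp_proj_image_eq[OF assms(1,2,4) A(2,1)] U_def[symmetric]
    by (rule emeasure_lborel_eq_0_iff_hyp_lebesgue[OF assms(4,5) U])
  ultimately show ?thesis by (simp add: zero_less_iff_neq_zero)
qed

end
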